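(* Let $n_1 = n_2 = 1$ and let $$S = \left\{ (x,y) \in [0,1]\times[0,1] \;\middle|\; q_k\, x y + a_k x + b_k y + c_k = 0,\; k \in \{1,2\} \right\},$$ where $q_k, a_k, b_k, c_k \in \mathbb{R}$ for $k\in\{1,2\}$. Assume that $S$ is nonempty and that there is no $\mu \in \mathbb{R}$ such that $q_1 xy + a_1 x + b_1 y + c_1 = \mu\,(q_2 xy + a_2 x + b_2 y + c_2)$ identically in $(x,y)$. For $\lambda = (\lambda_1,\lambda_2) \in \mathbb{R}^2$ let $$S_\lambda = \left\{ (x,y)\in[0,1]\times[0,1] \;\middle|\; \lambda_1 (q_1 xy + a_1 x + b_1 y + c_1) + \lambda_2 (q_2 xy + a_2 x + b_2 y + c_2) = 0 \right\}.$$ Then there exists $T \subseteq \mathbb{R}^2$ with $|T| \leq 3$ such that $$\operatorname{conv}(S) = \bigcap_{\lambda \in T} \operatorname{conv}(S_\lambda).$$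
   Context: $\operatorname{conv}(\cdot)$ denotes the convex hull and $|T|$ the cardinality of $T$. *)

theory Defs
  imports "HOL-Analysis.Analysis"
begin

definition bilin :: "real \<Rightarrow> real \<Rightarrow> real \<Rightarrow> real \<Rightarrow> real \<Rightarrow> real \<Rightarrow> real" where
  "bilin q a b c x y = q * x * y + a * x + b * y + c"

definition bilin_set ::
  "(nat \<Rightarrow> real) \<Rightarrow> (nat \<Rightarrow> real) \<Rightarrow> (nat \<Rightarrow> real) \<Rightarrow> (nat \<Rightarrow> real) \<Rightarrow> (real \<times> real) set" where
  "bilin_set q a b c =
     {(x, y) \<in> {0..1} \<times> {0..1}. \<forall>k\<in>{1,2}. bilin (q k) (a k) (b k) (c k) x y = 0}"

definition aggregated_set ::
  "(nat \<Rightarrow> real) \<Rightarrow> (nat \<Rightarrow> real) \<Rightarrow> (nat \<Rightarrow> real) \<Rightarrow> (nat \<Rightarrow> real) \<Rightarrow> real \<times> real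
     \<Rightarrow> (real \<times> real) set" where
  "aggregated_set q a b c l =
     {(x, y) \<in> {0..1} \<times> {0..1}.
        fst l * bilin (q 1) (a 1) (b 1) (c 1) x y + snd l * bilin (q 2) (a 2) (b 2) (c 2) x y = 0}"

end

(* Up to a change of basis of the pencil spanned by the two functions (and swapping x and y),
   one member is an affine function l = (y - p2) - m (x - p1), where (p1, p2) is a point of S,
   and another is the product h = (x - p1) (y - y1). Then S consists of the points of the line
   l = 0 at which h vanishes, so apart from degenerate cases S is one or two points, and the
   convex hulls have to cut the segment {l = 0} down to conv S.
   For u > 1 or u < -1 the zero set of h + u l in the box lies on a single branch of a hyperbola,
   hence its convex hull lies in the convex region bounded by that branch, which meets the line
   l = 0 in a ray from (p1, p2) if m = 0 (with direction given by the sign of u) and, for u = 2,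
   in the segment between the two zeros of h if m is nonzero and both zeros are in the box.
   If the second zero (q1, y1) lies outside the box, then one of the two degenerate hyperbolas
   (x - p1) (y - y1) = 0 and (x - q1) (y - p2) = 0 meets the box only in an axis-parallel
   segment through (p1, p2). *)
theory Submission
  imports Defs
begin

section \<open>Zero sets in the box, change of basis and swap of coordinates\<close>

definition box_zeros :: "(real \<Rightarrow> real \<Rightarrow> real) \<Rightarrow> (real \<times> real) set" where
  "box_zeros f = {(x, y) \<in> {0..1} \<times> {0..1}. f x y = 0}"

text \<open>Phrased for arbitrary functions instead of coefficients, so that it can be transported
  along basis changes and the swap of variables. \<open>finite T\<close> excludes infinite sets,
  whose \<open>card\<close> is 0.\<close>

definition three_aggregable ::
  "(real \<Rightarrow> real \<Rightarrow> real) \<Rightarrow> (real \<Rightarrow> real \<Rightarrow> real) \<Rightarrow> bool" where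
  "three_aggregable f g \<longleftrightarrow> (\<exists>T :: (real \<times> real) set. finite T \<and> card T \<le> 3 \<and>
     convex hull (box_zeros f \<inter> box_zeros g) =
       (\<Inter>l\<in>T. convex hull (box_zeros (\<lambda>x y. fst l * f x y + snd l * g x y))))"

lemma mem_box_zeros: "(x, y) \<in> box_zeros f \<longleftrightarrow> x \<in> {0..1} \<and> y \<in> {0..1} \<and> f x y = 0"
  by (auto simp: box_zeros_def)

text \<open>Common zeros are zeros of every aggregation, so only the inclusion into the hull of the
  common zeros needs an argument. The three multiplier pairs may coincide; a pair is repeated where
  fewer suffice.\<close>

lemma three_aggregableI:
  assumes "\<And>x y. (x, y) \<in> convex hull (box_zeros (\<lambda>x y. s1 * f x y + t1 * g x y)) \<Longrightarrow>
             (x, y) \<in> convex hull (box_zeros (\<lambda>x y. s2 * f x y + t2 * g x y)) \<Longrightarrow>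
             (x, y) \<in> convex hull (box_zeros (\<lambda>x y. s3 * f x y + t3 * g x y)) \<Longrightarrow>
             (x, y) \<in> convex hull (box_zeros f \<inter> box_zeros g)"
  shows "three_aggregable f g"
proof -
  let ?A = "\<lambda>l. convex hull (box_zeros (\<lambda>x y. fst l * f x y + snd l * g x y))"
  let ?T = "{(s1, t1), (s2, t2), (s3, t3)}"
  have "convex hull (box_zeros f \<inter> box_zeros g) \<subseteq> ?A l" for l
    by (rule hull_mono) (auto simp: mem_box_zeros)
  moreover have "(\<Inter>l\<in>?T. ?A l) \<subseteq> convex hull (box_zeros f \<inter> box_zeros g)"
    using assms by auto
  ultimately have "convex hull (box_zeros f \<inter> box_zeros g) = (\<Inter>l\<in>?T. ?A l)"
    by blast
  moreover have "card ?T \<le> 3"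
    by (simp add: card_insert_if)
  ultimately show ?thesis
    unfolding three_aggregable_def by (intro exI[of _ ?T]) simp
qed

text \<open>An aggregation of \<open>f'\<close> and \<open>g'\<close> is one of \<open>f\<close> and
  \<open>g\<close>, with multipliers transformed by the transposed matrix; invertibility keeps the
  common zeros the same.\<close>

lemma three_aggregable_change_basis:
  assumes "three_aggregable f' g'"
    and f': "\<And>x y. f' x y = p * f x y + r * g x y"
    and g': "\<And>x y. g' x y = s * f x y + t * g x y"
    and det: "p * t - r * s \<noteq> 0"
  shows "three_aggregable f g"
proof -
  obtain T where T: "finite T" "card T \<le> 3"
    "convex hull (box_zeros f' \<inter> box_zeros g') =
       (\<Inter>l\<in>T. convex hull (box_zeros (\<lambda>x y. fst l * f' x y + snd l * g' x y)))"
    using assms(1) unfolding three_aggregable_def by blast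
  define \<phi> where "\<phi> l = (fst l * p + snd l * s, fst l * r + snd l * t)" for l :: "real \<times> real"
  have inv: "f x y = 0 \<and> g x y = 0 \<longleftrightarrow> f' x y = 0 \<and> g' x y = 0" for x y
  proof
    assume *: "f' x y = 0 \<and> g' x y = 0"
    \<comment> \<open>Cramer's rule.\<close>
    have "(p * t - r * s) * f x y = t * f' x y - r * g' x y"
      "(p * t - r * s) * g x y = p * g' x y - s * f' x y"
      by (simp_all add: f' g' algebra_simps)
    with * det show "f x y = 0 \<and> g x y = 0" by simp
  qed (simp add: f' g')
  have "box_zeros f \<inter> box_zeros g = box_zeros f' \<inter> box_zeros g'"
    unfolding box_zeros_def using inv by auto
  moreover have "(\<lambda>x y. fst l * f' x y + snd l * g' x y) =
      (\<lambda>x y. fst (\<phi> l) * f x y + snd (\<phi> l) * g x y)" for l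
    by (intro ext) (simp add: f' g' \<phi>_def algebra_simps)
  ultimately have "convex hull (box_zeros f \<inter> box_zeros g) =
       (\<Inter>l\<in>\<phi> ` T. convex hull (box_zeros (\<lambda>x y. fst l * f x y + snd l * g x y)))"
    using T(3) by simp
  moreover have "finite (\<phi> ` T)" "card (\<phi> ` T) \<le> 3"
    using T card_image_le[of T \<phi>] by auto
  ultimately show ?thesis unfolding three_aggregable_def by blast
qed

text \<open>Reflection in the diagonal is a linear bijection that preserves the box, so it commutes
  with zero sets, hulls and intersections.\<close>

lemma three_aggregable_swap:
  assumes "three_aggregable (\<lambda>x y. f y x) (\<lambda>x y. g y x)"
  shows "three_aggregable f g"
proof -
  have lin: "linear (prod.swap :: real \<times> real \<Rightarrow> real \<times> real)"
    by (auto intro!: linearI)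
  have Z: "box_zeros (\<lambda>x y. k y x) = prod.swap ` box_zeros k" for k
    by (force simp: box_zeros_def image_iff)
  have inj: "inj (prod.swap :: real \<times> real \<Rightarrow> real \<times> real)"
    by simp
  obtain T where T: "finite T" "card T \<le> 3"
    "convex hull (box_zeros (\<lambda>x y. f y x) \<inter> box_zeros (\<lambda>x y. g y x)) =
       (\<Inter>l\<in>T. convex hull (box_zeros (\<lambda>x y. fst l * f y x + snd l * g y x)))"
    using assms unfolding three_aggregable_def by blast
  have hull: "convex hull (prod.swap ` A) = prod.swap ` (convex hull A)" for A :: "(real \<times> real) set"
    using convex_hull_linear_image[OF lin] by simp
  have "prod.swap ` (convex hull (box_zeros f \<inter> box_zeros g)) =
       (\<Inter>l\<in>T. prod.swap ` (convex hull (box_zeros (\<lambda>x y. fst l * f x y + snd l * g x y))))"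
    using T(3) Z[of f] Z[of g] Z[of "\<lambda>x y. fst l * f x y + snd l * g x y" for l]
    by (simp add: hull flip: image_Int[OF inj])
  also have "\<dots> = prod.swap ` (\<Inter>l\<in>T. convex hull (box_zeros (\<lambda>x y. fst l * f x y + snd l * g x y)))"
    by (rule bij_image_INT[OF bij_swap, symmetric])
  finally have "convex hull (box_zeros f \<inter> box_zeros g) =
       (\<Inter>l\<in>T. convex hull (box_zeros (\<lambda>x y. fst l * f x y + snd l * g x y)))"
    by (rule inj_image_eq_iff[OF inj, THEN iffD1])
  with T(1,2) show ?thesis unfolding three_aggregable_def by (intro exI[of _ T] conjI)
qed

section \<open>Convexity of line sections and of regions bounded by a hyperbola branch\<close>

lemma convex_box_zeros_affine: "convex (box_zeros (\<lambda>x y. a * x + b * y + c))"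
proof -
  have "box_zeros (\<lambda>x y. a * x + b * y + c) = ({0..1} \<times> {0..1}) \<inter> {z. inner (a, b) z = - c}"
    by (auto simp: box_zeros_def)
  then show ?thesis
    by (simp add: convex_Int convex_Times convex_hyperplane del: inner_Pair)
qed

text \<open>In the coordinates \<open>X\<close>, \<open>Y\<close> of the proof, expanding the
  product at a convex combination leaves the mixed term \<open>X * Y' + X' * Y\<close>, which AM-GM
  bounds below by \<open>2 * k\<close>.\<close>

lemma convex_hyperbola:
  fixes k e d x0 y0 :: real
  assumes "0 \<le> k"
  shows "convex {(x, y). 0 < e * (x - x0) \<and> k \<le> (e * (x - x0)) * (d * (y - y0))}"
    (is "convex ?C")
proof (rule convexI)
  fix z z' :: "real \<times> real" and u v :: real
  assume uv: "0 \<le> u" "0 \<le> v" "u + v = 1" and zz': "z \<in> ?C" "z' \<in> ?C"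
  obtain x y x' y' where z: "z = (x, y)" and z': "z' = (x', y')" by fastforce
  have 1: "0 < e * (x - x0)" "k \<le> (e * (x - x0)) * (d * (y - y0))"
    and 2: "0 < e * (x' - x0)" "k \<le> (e * (x' - x0)) * (d * (y' - y0))"
    using zz' by (simp_all add: z z')
  define X Y X' Y' where "X = e * (x - x0)" "Y = d * (y - y0)" "X' = e * (x' - x0)" "Y' = d * (y' - y0)"
  note 1 = 1[folded X_Y_X'_Y'_def] and 2 = 2[folded X_Y_X'_Y'_def]
  have v: "v = 1 - u" using uv by simp
  have comb: "e * (u * x + v * x' - x0) = u * X + v * X'" "d * (u * y + v * y' - y0) = u * Y + v * Y'"
    by (simp_all add: X_Y_X'_Y'_def v algebra_simps)
  have nonneg: "0 \<le> Y" "0 \<le> Y'"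
    using 1 2 assms by (smt (verit) mult_pos_neg)+
  have "k * k \<le> (X * Y) * (X' * Y')"
    using 1 2 assms by (intro mult_mono) auto
  then have "(2 * k)\<^sup>2 \<le> 4 * ((X * Y') * (X' * Y))"
    by (simp add: power2_eq_square algebra_simps)
  also have "\<dots> \<le> (X * Y' + X' * Y)\<^sup>2"
    using zero_le_power2[of "X * Y' - X' * Y"] by (simp add: power2_eq_square algebra_simps)
  finally have cross: "2 * k \<le> X * Y' + X' * Y"
    by (rule power2_le_imp_le) (use 1 2 nonneg in auto)
  have "k = u\<^sup>2 * k + v\<^sup>2 * k + u * v * (2 * k)"
    by (simp add: v power2_eq_square algebra_simps)
  also have "\<dots> \<le> u\<^sup>2 * (X * Y) + v\<^sup>2 * (X' * Y') + u * v * (X * Y' + X' * Y)"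
    using uv 1 2 cross by (intro add_mono mult_left_mono) auto
  also have "\<dots> = (u * X + v * X') * (u * Y + v * Y')"
    by (simp add: power2_eq_square algebra_simps)
  finally have "k \<le> (u * X + v * X') * (u * Y + v * Y')" .
  moreover have "0 < u * X + v * X'"
    using uv 1 2 by (smt (verit) mult_nonneg_nonneg mult_pos_pos)
  ultimately show "u *\<^sub>R z + v *\<^sub>R z' \<in> ?C"
    by (simp add: comb z z')
qed

text \<open>The vertical asymptote \<open>x = x0\<close> misses the box, so the zeros lie on one
  side of it. For \<open>K \<noteq> 0\<close> the conclusion is the inequality of the convex region
  bounded by that branch.\<close>

lemma convex_hull_hyperbola_branch:
  assumes "(x, y) \<in> convex hull (box_zeros (\<lambda>x y. (x - x0) * (y - y0) + K))"
    and x0: "x0 < 0 \<or> 1 < x0"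
  shows "K * ((x - x0) * (y - y0) + K) \<le> 0"
proof -
  \<comment> \<open>The sign \<open>e\<close> makes \<open>e * (x - x0)\<close> positive on the box.
    The factor \<open>- e * K\<close> gives the product the value \<open>K\<^sup>2\<close> on the
    curve, which treats both signs of \<open>K\<close> and \<open>K = 0\<close> at once.\<close>
  define e :: real where "e = (if x0 < 0 then 1 else - 1)"
  let ?C = "{(x, y). 0 < e * (x - x0) \<and> K\<^sup>2 \<le> (e * (x - x0)) * ((- e * K) * (y - y0))}"
  have prod: "(e * X) * ((- e * K) * Y) = - K * (X * Y)" for X Y
    by (simp add: e_def)
  have "box_zeros (\<lambda>x y. (x - x0) * (y - y0) + K) \<subseteq> ?C"
  proof clarify
    fix x y assume "(x, y) \<in> box_zeros (\<lambda>x y. (x - x0) * (y - y0) + K)"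
    then have xy: "0 \<le> x" "x \<le> 1" "(x - x0) * (y - y0) = - K"
      by (auto simp: mem_box_zeros)
    then show "0 < e * (x - x0) \<and> K\<^sup>2 \<le> (e * (x - x0)) * ((- e * K) * (y - y0))"
      using x0 by (simp only: prod) (auto simp: e_def power2_eq_square)
  qed
  then have "convex hull (box_zeros (\<lambda>x y. (x - x0) * (y - y0) + K)) \<subseteq> ?C"
    by (intro hull_minimal convex_hyperbola) auto
  then have "K\<^sup>2 \<le> - K * ((x - x0) * (y - y0))"
    using assms(1) by (auto simp only: prod)
  then show ?thesis by (simp add: power2_eq_square algebra_simps)
qed

section \<open>Affine pairs and the normal form\<close>

lemma three_aggregable_affine:
  "three_aggregable (\<lambda>x y. a * x + b * y + c) (\<lambda>x y. a' * x + b' * y + c')"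
proof -
  let ?f = "\<lambda>x y. a * x + b * y + c" and ?g = "\<lambda>x y. a' * x + b' * y + c'"
  have "convex hull (box_zeros ?f) = box_zeros ?f" "convex hull (box_zeros ?g) = box_zeros ?g"
    by (intro hull_same convex_box_zeros_affine)+
  moreover have "convex hull (box_zeros ?f \<inter> box_zeros ?g) = box_zeros ?f \<inter> box_zeros ?g"
    by (intro hull_same convex_Int convex_box_zeros_affine)
  ultimately show ?thesis
    by (intro three_aggregableI[of 1 ?f 0 ?g 0 1 0 1]) simp
qed

lemma three_aggregable_normal_form:
  fixes m p1 p2 y1 :: real
  defines "l \<equiv> \<lambda>x y. (y - p2) - m * (x - p1)" and "h \<equiv> \<lambda>x y. (x - p1) * (y - y1)"
  assumes p: "p1 \<in> {0..1}" "p2 \<in> {0..1}"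
  shows "three_aggregable l h"
proof -
  let ?S = "box_zeros l \<inter> box_zeros h"
  define Z where "Z s t = convex hull (box_zeros (\<lambda>x y. s * l x y + t * h x y))" for s t
  have l_affine: "l = (\<lambda>x y. (- m) * x + 1 * y + (m * p1 - p2))"
    by (intro ext) (simp add: l_def algebra_simps)
  have Zl: "Z 1 0 = box_zeros l"
    using convex_box_zeros_affine[of "- m" 1 "m * p1 - p2"] by (simp add: Z_def l_affine hull_same)
  have pS: "(p1, p2) \<in> convex hull ?S"
    using p by (intro hull_inc) (auto simp: mem_box_zeros l_def h_def)
  have on_line: "y - p2 = m * (x - p1)" if "(x, y) \<in> Z 1 0" for x y
    using that by (simp add: Zl mem_box_zeros l_def)
  \<comment> \<open>The function \<open>h + u * l\<close> has the vertical asymptote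
    \<open>x = p1 - u\<close>, which lies outside the box when \<open>u\<close> exceeds 1 in
    absolute value. On the line \<open>l = 0\<close> it equals \<open>h\<close>, so the branch
    inequality becomes a sign condition on \<open>h\<close>.\<close>
  have cut: "u * (m * u + y1 - p2) * h x y \<le> 0"
    if "(x, y) \<in> Z 1 0" "(x, y) \<in> Z u 1" "1 < u \<or> u < - 1" for u x y
  proof -
    define K where "K = u * (m * u + y1 - p2)"
    have shift: "(\<lambda>x y. u * l x y + 1 * h x y) = (\<lambda>x y. (x - (p1 - u)) * (y - (y1 + u * m)) + K)"
      by (intro ext) (simp add: l_def h_def K_def algebra_simps)
    have "K * ((x - (p1 - u)) * (y - (y1 + u * m)) + K) \<le> 0"
      using that(2,3) p unfolding Z_def shift by (intro convex_hull_hyperbola_branch) auto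
    then have "K * (u * l x y + 1 * h x y) \<le> 0"
      using fun_cong[OF fun_cong[OF shift]] by metis
    moreover have "l x y = 0"
      using that(1) by (simp add: Zl mem_box_zeros)
    ultimately show ?thesis by (simp add: K_def)
  qed
  \<comment> \<open>If the intersection forces \<open>x = p1\<close>, the line equation leaves only
    the common zero \<open>(p1, p2)\<close>.\<close>
  have single: "three_aggregable l h"
    if "\<And>x y. (x, y) \<in> Z 1 0 \<Longrightarrow> (x, y) \<in> Z s t \<Longrightarrow> (x, y) \<in> Z s' t' \<Longrightarrow> x = p1" for s t s' t'
  proof (rule three_aggregableI[of 1 l 0 h s t s' t', folded Z_def])
    fix x y assume *: "(x, y) \<in> Z 1 0" "(x, y) \<in> Z s t" "(x, y) \<in> Z s' t'"
    then have "x = p1" by (rule that)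
    with on_line[OF *(1)] pS show "(x, y) \<in> convex hull ?S" by simp
  qed
  show ?thesis
  proof (cases "m = 0")
    case True
    show ?thesis
    proof (cases "y1 = p2")
      case True
      with \<open>m = 0\<close> have "?S = box_zeros l"
        by (auto simp: l_def h_def mem_box_zeros)
      then show ?thesis
        by (intro three_aggregableI[of 1 l 0 h 1 0 1 0]) simp
    next
      case False
      show ?thesis
      \<comment> \<open>The opposite values 2 and -2 of \<open>u\<close> bound \<open>x - p1\<close>
        from both sides.\<close>
      proof (rule single[of 2 1 "- 2" 1])
        fix x y assume *: "(x, y) \<in> Z 1 0" "(x, y) \<in> Z 2 1" "(x, y) \<in> Z (- 2) 1"
        have "y = p2" using on_line[OF *(1)] \<open>m = 0\<close> by simp
        then have "(y1 - p2)\<^sup>2 * (x - p1) = 0"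
          using cut[OF *(1,2)] cut[OF *(1,3)] \<open>m = 0\<close>
          by (simp add: h_def power2_eq_square algebra_simps)
        with False show "x = p1" by simp
      qed
    qed
  next
    case False
    \<comment> \<open>The line \<open>l = 0\<close> meets the other factor's zero line
      \<open>y = y1\<close> at \<open>(q1, y1)\<close>.\<close>
    define q1 where "q1 = p1 + (y1 - p2) / m"
    have y1: "y1 = p2 + m * (q1 - p1)" using False by (simp add: q1_def)
    consider "y1 \<notin> {0..1}" | "q1 \<notin> {0..1}" | "q1 \<in> {0..1}" "y1 \<in> {0..1}" by blast
    then show ?thesis
    proof cases
      case 1
      have "box_zeros (\<lambda>x y. 0 * l x y + 1 * h x y) \<subseteq> box_zeros (\<lambda>x y. 1 * x + 0 * y + (- p1))"
        using 1 by (auto simp: mem_box_zeros h_def)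
      then have "Z 0 1 \<subseteq> box_zeros (\<lambda>x y. 1 * x + 0 * y + (- p1))"
        unfolding Z_def by (intro hull_minimal convex_box_zeros_affine)
      then show ?thesis
        by (intro single[of 0 1 0 1]) (auto simp: mem_box_zeros)
    next
      case 2
      \<comment> \<open>The other degenerate member of the pencil through both points. With
        \<open>q1\<close> outside the interval, its zeros in the box satisfy \<open>y = p2\<close>,
        and on the line with \<open>m \<noteq> 0\<close> this gives \<open>x = p1\<close>.\<close>
      have fac: "(p1 - q1) * l x y + 1 * h x y = (x - q1) * (y - p2)" for x y
        by (simp add: y1 l_def h_def algebra_simps)
      have "box_zeros (\<lambda>x y. (p1 - q1) * l x y + 1 * h x y) \<subseteq> box_zeros (\<lambda>x y. 0 * x + 1 * y + (- p2))"
        unfolding fac using 2 by (auto simp: mem_box_zeros)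
      then have "Z (p1 - q1) 1 \<subseteq> box_zeros (\<lambda>x y. 0 * x + 1 * y + (- p2))"
        unfolding Z_def by (intro hull_minimal convex_box_zeros_affine)
      then have "y = p2" if "(x, y) \<in> Z (p1 - q1) 1" for x y
        using that by (auto simp: mem_box_zeros)
      then show ?thesis
        using on_line False by (intro single[of "p1 - q1" 1 "p1 - q1" 1]) force
    next
      case 3
      have qS: "(q1, y1) \<in> convex hull ?S"
        using 3 by (intro hull_inc) (auto simp: mem_box_zeros l_def h_def y1)
      show ?thesis
      proof (rule three_aggregableI[of 1 l 0 h 2 1 2 1, folded Z_def])
        fix x y assume *: "(x, y) \<in> Z 1 0" "(x, y) \<in> Z 2 1"
        have y: "y = p2 + m * (x - p1)" using on_line[OF *(1)] by simp
        \<comment> \<open>On the line, \<open>h\<close> equals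
          \<open>m * (x - p1) * (x - q1)\<close>, and the factor in \<open>cut\<close> for
          \<open>u = 2\<close> is \<open>2 * m * (2 + q1 - p1)\<close>. Since \<open>q1 - p1\<close>
          is at least -1, the sign condition puts \<open>x\<close> between \<open>p1\<close> and
          \<open>q1\<close>.\<close>
        have "(2 * m\<^sup>2 * (2 + q1 - p1)) * ((x - p1) * (x - q1)) \<le> 0"
          using cut[OF *] by (simp add: h_def y y1 power2_eq_square algebra_simps)
        moreover have "0 < 2 * m\<^sup>2 * (2 + q1 - p1)" using p 3 False by auto
        ultimately have "(x - p1) * (x - q1) \<le> 0" by (metis linorder_not_less mult_pos_pos)
        then have "x \<in> closed_segment p1 q1"
          by (auto simp: closed_segment_eq_real_ivl mult_le_0_iff)
        then obtain t where t: "0 \<le> t" "t \<le> 1" "x = (1 - t) * p1 + t * q1"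
          by (auto simp: closed_segment_def)
        then have "(x, y) = (1 - t) *\<^sub>R (p1, p2) + t *\<^sub>R (q1, y1)"
          by (simp add: y y1 t(3) algebra_simps)
        also have "\<dots> \<in> convex hull ?S"
          using t pS qS by (intro convexD[OF convex_convex_hull]) auto
        finally show "(x, y) \<in> convex hull ?S" .
      qed
    qed
  qed
qed

section \<open>Reduction of a general pair to the normal form\<close>

text \<open>Expand the bilinear function around the common zero \<open>(p1, p2)\<close> and subtract
  the multiple of the line function that cancels the linear term in \<open>y - p2\<close>; the rest
  has the factor \<open>x - p1\<close>.\<close>

lemma three_aggregable_affine_bilin:
  assumes k: "k \<noteq> 0" and B: "B \<noteq> 0"
    and p: "(p1, p2) \<in> box_zeros (bilin 0 A B C) \<inter> box_zeros (bilin k a b c)"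
  shows "three_aggregable (bilin 0 A B C) (bilin k a b c)"
proof -
  define m where "m = - A / B"
  \<comment> \<open>The partial derivatives of \<open>bilin k a b c\<close> at
    \<open>(p1, p2)\<close>.\<close>
  define a' b' where "a' = k * p2 + a" and "b' = k * p1 + b"
  define y1 where "y1 = p2 - (a' + b' * m) / k"
  have C: "C = - A * p1 - B * p2" and c: "c = - k * p1 * p2 - a * p1 - b * p2"
    and box: "p1 \<in> {0..1}" "p2 \<in> {0..1}"
    using p by (auto simp: mem_box_zeros bilin_def)
  have A: "A = - B * m" using B by (simp add: m_def)
  have y1: "k * y1 = k * p2 - (a' + b' * m)" using k by (simp add: y1_def field_simps)
  have l: "(y - p2) - m * (x - p1) = (1 / B) * bilin 0 A B C x y + 0 * bilin k a b c x y" for x y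
    using B by (simp add: bilin_def C A field_simps)
  have "k * ((x - p1) * (y - y1)) =
      k * ((- b' / (k * B)) * bilin 0 A B C x y + (1 / k) * bilin k a b c x y)" for x y
  proof -
    have "k * ((x - p1) * (y - y1)) = (x - p1) * (k * y - k * y1)"
      by (simp add: algebra_simps)
    also have "\<dots> = - b' * ((y - p2) - m * (x - p1)) + bilin k a b c x y"
      unfolding y1 by (simp add: bilin_def c a'_def b'_def algebra_simps)
    also have "\<dots> = k * ((- b' / (k * B)) * bilin 0 A B C x y + (1 / k) * bilin k a b c x y)"
      unfolding l using k B by (simp add: field_simps)
    finally show ?thesis .
  qed
  then have h: "(x - p1) * (y - y1) = (- b' / (k * B)) * bilin 0 A B C x y + (1 / k) * bilin k a b c x y"
    for x y
    using k mult_left_cancel by blast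
  show ?thesis
    by (rule three_aggregable_change_basis[OF three_aggregable_normal_form[OF box] l h])
      (use k B in simp)
qed

lemma three_aggregable_bilin:
  assumes "box_zeros (bilin k a b c) \<inter> box_zeros (bilin k' a' b' c') \<noteq> {}"
  shows "three_aggregable (bilin k a b c) (bilin k' a' b' c')"
proof (cases "k = 0 \<and> k' = 0")
  case True
  then have "bilin k a b c = (\<lambda>x y. a * x + b * y + c)"
    "bilin k' a' b' c' = (\<lambda>x y. a' * x + b' * y + c')"
    by (auto simp: bilin_def fun_eq_iff)
  then show ?thesis by (simp add: three_aggregable_affine)
next
  case False
  \<comment> \<open>The combination with multipliers \<open>k'\<close> and \<open>- k\<close>
    eliminates the product term. Pairing it with multipliers \<open>k\<close> and \<open>k'\<close>
    gives determinant \<open>K\<close>, a nonzero sum of squares, whichever of \<open>k\<close>,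
    \<open>k'\<close> vanishes.\<close>
  define A B C where "A = k' * a - k * a'" and "B = k' * b - k * b'" and "C = k' * c - k * c'"
  define K D E F where "K = k * k + k' * k'" and "D = k * a + k' * a'" and "E = k * b + k' * b'"
    and "F = k * c + k' * c'"
  let ?f = "bilin 0 A B C" and ?g = "bilin K D E F"
  have K: "K \<noteq> 0" using False by (simp add: K_def sum_squares_eq_zero_iff)
  have f: "?f x y = k' * bilin k a b c x y + (- k) * bilin k' a' b' c' x y" for x y
    by (simp add: bilin_def A_def B_def C_def algebra_simps)
  have g: "?g x y = k * bilin k a b c x y + k' * bilin k' a' b' c' x y" for x y
    by (simp add: bilin_def K_def D_def E_def F_def algebra_simps)
  obtain p1 p2 where "(p1, p2) \<in> box_zeros (bilin k a b c) \<inter> box_zeros (bilin k' a' b' c')"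
    using assms by fast
  then have p: "(p1, p2) \<in> box_zeros ?f \<inter> box_zeros ?g"
    by (auto simp: mem_box_zeros f g)
  have "three_aggregable ?f ?g"
  proof (cases "B = 0")
    case False
    then show ?thesis by (rule three_aggregable_affine_bilin[OF K _ p])
  next
    case B: True
    show ?thesis
    proof (cases "A = 0")
      case True
      \<comment> \<open>A constant that vanishes at a point is zero.\<close>
      with B p have "?f = (\<lambda>x y. 0)"
        by (auto simp: mem_box_zeros bilin_def fun_eq_iff)
      then have "box_zeros ?f \<inter> box_zeros ?g = box_zeros ?g"
        by (auto simp: mem_box_zeros)
      then show ?thesis
        by (intro three_aggregableI[of 0 _ 1 _ 0 1 0 1]) simp
    next
      case False
      \<comment> \<open>The line is vertical here; exchanging the coordinates makes it
        horizontal.\<close>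
      have swap: "(\<lambda>x y. bilin k a b c y x) = bilin k b a c" for k a b c
        by (auto simp: bilin_def fun_eq_iff)
      have "(p2, p1) \<in> box_zeros (bilin 0 B A C) \<inter> box_zeros (bilin K E D F)"
        using p by (auto simp: mem_box_zeros bilin_def algebra_simps)
      from three_aggregable_affine_bilin[OF K False this]
      have "three_aggregable (\<lambda>x y. ?f y x) (\<lambda>x y. ?g y x)"
        by (simp only: swap)
      then show ?thesis by (rule three_aggregable_swap)
    qed
  qed
  then show ?thesis
    by (rule three_aggregable_change_basis[OF _ f g]) (use K in \<open>auto simp: K_def\<close>)
qed

theorem theorem1:
  fixes q a b c :: "nat \<Rightarrow> real"
  assumes "bilin_set q a b c \<noteq> {}"
    and "\<not> (\<exists>\<mu>::real. \<forall>x y. bilin (q 1) (a 1) (b 1) (c 1) x y = \<mu> * bilin (q 2) (a 2) (b 2) (c 2) x y)"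
  shows "\<exists>T :: (real \<times> real) set. finite T \<and> card T \<le> 3 \<and>
           convex hull (bilin_set q a b c) = (\<Inter>l\<in>T. convex hull (aggregated_set q a b c l))"
proof -
  have "bilin_set q a b c =
      box_zeros (bilin (q 1) (a 1) (b 1) (c 1)) \<inter> box_zeros (bilin (q 2) (a 2) (b 2) (c 2))"
    by (auto simp: bilin_set_def box_zeros_def)
  moreover have "aggregated_set q a b c l = box_zeros (\<lambda>x y.
      fst l * bilin (q 1) (a 1) (b 1) (c 1) x y + snd l * bilin (q 2) (a 2) (b 2) (c 2) x y)" for l
    by (simp add: aggregated_set_def box_zeros_def)
  ultimately show ?thesis
    using three_aggregable_bilin assms(1) unfolding three_aggregable_def by simp
qed

end
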